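(* Let $\mathcal{K}$ be a reflexive (complete idempotent) semiring, let $(Y,X)$ be a pre-dual pair for $\mathcal{K}$ such that $Y$ separates $X$, and let $W\subset X^2$ be a complete congruence. If $s,t\in X$ are such that $(s,t)\notin W$, then there exists $y\in Y$ such that $$(f,g)\in W\implies\langle y\mid f\rangle=\langle y\mid g\rangle$$ and $$\langle y\mid s\rangle\neq\langle y\mid t\rangle.$$
   Context: An idempotent semiring $(\mathcal{K},\oplus,\otimes,\varepsilon,e)$ is ordered by the natural order $a\leq b\iff a\oplus b=b$; $\vee Q$ denotes the least upper bound of $Q$. A map $F$ between ordered sets in which every subset has a least upper bound is continuous if $F(\vee Q)=\vee F(Q)$ for all subsets $Q$. $\mathcal{K}$ is complete if every subset has a least upper bound and all left and right multiplications are continuous. A complete idempotent semiring $\mathcal{K}$ is reflexive if there exists $\varphi\in\mathcal{K}$ such that, setting $\lambda^-:=\vee\{\mu\in\mathcal{K}\mid\lambda\mu\leq\varphi\}$ and ${}^-\lambda:=\vee\{\mu\in\mathcal{K}\mid\mu\lambda\leq\varphi\}$, one has ${}^-(\lambda^-)=\lambda$ and $({}^-\lambda)^-=\lambda$ for all $\lambda\in\mathcal{K}$. A right $\mathcal{K}$-semimodule $X$ is a commutative monoid $(X,\oplus,\varepsilon)$ with a right action satisfying $(x\oplus z)\lambda=x\lambda\oplus z\lambda$, $x(\lambda\oplus\mu)=x\lambda\oplus x\mu$, $x(\lambda\mu)=(x\lambda)\mu$, $x\varepsilon=\varepsilon$, $\varepsilon\lambda=\varepsilon$, $xe=x$; it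 is then idempotent and naturally ordered by $x\le z\iff x\oplus z=z$. It is complete if every subset has a least upper bound and the maps $z\mapsto z\lambda$ ($X\to X$) and $\mu\mapsto u\mu$ ($\mathcal{K}\to X$) are continuous for all $\lambda\in\mathcal{K}$, $u\in X$. Left semimodules are defined dually. A pre-dual pair $(Y,X)$ for $\mathcal{K}$ consists of a complete right $\mathcal{K}$-semimodule $X$ and a complete left $\mathcal{K}$-semimodule $Y$ with a bracket $\langle\cdot\mid\cdot\rangle:Y\times X\to\mathcal{K}$ such that for all $x\in X$, $y\in Y$ the maps $y\mapsto\langle y\mid x\rangle$ and $x\mapsto\langle y\mid x\rangle$ are respectively left and right linear (preserve finite sums and commute with the scalar action), and continuous. $Y$ separates $X$ if $(\forall y\in Y,\ \langle y\mid x\rangle=\langle y\mid x'\rangle)\implies x=x'$. A subsemimodule is a subset stable under all $x\lambda\oplus z\mu$; it is complete if it contains $\vee Q$ for each of its subsets $Q$. $X^2$ carries componentwise operations. A congruence is a subsemimodule $W\subset X^2$ which is an equivalence relation on $X$; a complete congruence is one that is complete as a subsemimodule. *)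

theory Defs
  imports Main "HOL-Library.Product_Plus" "HOL-Library.Product_Order"
begin

text \<open>
  The order in the following classes is not additional structure: it is the natural order
  of the addition. Likewise, since \<open>complete_lattice\<close> operations are determined by the
  order, a type belongs to one of the complete classes exactly when every subset has a least upper
  bound for the natural order and the stated continuity axioms hold. The least upper bound of
  \<open>Q\<close> is \<open>Sup Q\<close>; that of the empty set is \<open>0\<close>.
\<close>

class idem_monoid = comm_monoid_add + order +
  assumes natural_order: "a \<le> b \<longleftrightarrow> a + b = b"

class complete_idem_monoid = idem_monoid + complete_lattice

text \<open>\<open>semiring_0 + monoid_mult\<close> rather than \<open>semiring_1\<close>, as the latter imposes \<open>0 \<noteq> 1\<close>.\<close>

class idem_semiring = semiring_0 + monoid_mult + idem_monoid

definition vee_continuous :: "('a::complete_lattice \<Rightarrow> 'b::complete_lattice) \<Rightarrow> bool"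
  where "vee_continuous F \<longleftrightarrow> (\<forall>Q. F (Sup Q) = Sup (F ` Q))"

class complete_idem_semiring = idem_semiring + complete_idem_monoid +
  assumes mult_Sup_left: "a * Sup Q = Sup ((\<lambda>b. a * b) ` Q)"
    and mult_Sup_right: "Sup Q * a = Sup ((\<lambda>b. b * a) ` Q)"

lemma vee_continuous_mult:
  fixes a :: "'k::complete_idem_semiring"
  shows "vee_continuous (\<lambda>b. a * b)" and "vee_continuous (\<lambda>b. b * a)"
  by (simp_all add: vee_continuous_def mult_Sup_left mult_Sup_right)

context complete_idem_semiring
begin

text \<open>\<open>right_dual \<phi> l\<close> is $l^-$ and \<open>left_dual \<phi> l\<close> is ${}^-l$.\<close>

definition right_dual :: "'a \<Rightarrow> 'a \<Rightarrow> 'a"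
  where "right_dual \<phi> l = Sup {m. l * m \<le> \<phi>}"

definition left_dual :: "'a \<Rightarrow> 'a \<Rightarrow> 'a"
  where "left_dual \<phi> l = Sup {m. m * l \<le> \<phi>}"

end

class reflexive_semiring = complete_idem_semiring +
  assumes ex_reflexive:
    "\<exists>\<phi>. \<forall>l. left_dual \<phi> (right_dual \<phi> l) = l \<and> right_dual \<phi> (left_dual \<phi> l) = l"

locale right_semimodule =
  fixes rscale :: "'x::comm_monoid_add \<Rightarrow> 'k::idem_semiring \<Rightarrow> 'x"
  assumes rscale_add_left: "rscale (x + z) l = rscale x l + rscale z l"
    and rscale_add_right: "rscale x (l + m) = rscale x l + rscale x m"
    and rscale_mult: "rscale x (l * m) = rscale (rscale x l) m"
    and rscale_zero_right: "rscale x 0 = 0"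
    and rscale_zero_left: "rscale 0 l = 0"
    and rscale_one: "rscale x 1 = x"

locale complete_right_semimodule = right_semimodule rscale
  for rscale :: "'x::complete_idem_monoid \<Rightarrow> 'k::complete_idem_semiring \<Rightarrow> 'x" +
  assumes rscale_continuous_left: "vee_continuous (\<lambda>z. rscale z l)"
    and rscale_continuous_right: "vee_continuous (\<lambda>m. rscale u m)"

locale left_semimodule =
  fixes lscale :: "'k::idem_semiring \<Rightarrow> 'y::comm_monoid_add \<Rightarrow> 'y"
  assumes lscale_add_right: "lscale l (y + z) = lscale l y + lscale l z"
    and lscale_add_left: "lscale (l + m) y = lscale l y + lscale m y"
    and lscale_mult: "lscale (l * m) y = lscale l (lscale m y)"
    and lscale_zero_left: "lscale 0 y = 0"
    and lscale_zero_right: "lscale l 0 = 0"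
    and lscale_one: "lscale 1 y = y"

locale complete_left_semimodule = left_semimodule lscale
  for lscale :: "'k::complete_idem_semiring \<Rightarrow> 'y::complete_idem_monoid \<Rightarrow> 'y" +
  assumes lscale_continuous_right: "vee_continuous (\<lambda>z. lscale l z)"
    and lscale_continuous_left: "vee_continuous (\<lambda>m. lscale m u)"

definition right_linear ::
    "('x::comm_monoid_add \<Rightarrow> 'k::idem_semiring \<Rightarrow> 'x) \<Rightarrow> ('x \<Rightarrow> 'k) \<Rightarrow> bool"
  where "right_linear rscale F \<longleftrightarrow>
    F 0 = 0 \<and> (\<forall>x z. F (x + z) = F x + F z) \<and> (\<forall>x l. F (rscale x l) = F x * l)"

definition left_linear ::
    "('k::idem_semiring \<Rightarrow> 'y::comm_monoid_add \<Rightarrow> 'y) \<Rightarrow> ('y \<Rightarrow> 'k) \<Rightarrow> bool"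
  where "left_linear lscale F \<longleftrightarrow>
    F 0 = 0 \<and> (\<forall>y z. F (y + z) = F y + F z) \<and> (\<forall>l y. F (lscale l y) = l * F y)"

locale pre_dual_pair =
  complete_right_semimodule rscale + complete_left_semimodule lscale
  for rscale :: "'x::complete_idem_monoid \<Rightarrow> 'k::complete_idem_semiring \<Rightarrow> 'x"
    and lscale :: "'k \<Rightarrow> 'y::complete_idem_monoid \<Rightarrow> 'y" +
  fixes bracket :: "'y \<Rightarrow> 'x \<Rightarrow> 'k"
  assumes bracket_left_linear: "left_linear lscale (\<lambda>y. bracket y x)"
    and bracket_right_linear: "right_linear rscale (\<lambda>x. bracket y x)"
    and bracket_continuous_left: "vee_continuous (\<lambda>y. bracket y x)"
    and bracket_continuous_right: "vee_continuous (\<lambda>x. bracket y x)"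

definition separates :: "('y \<Rightarrow> 'x \<Rightarrow> 'k) \<Rightarrow> bool"
  where "separates bracket \<longleftrightarrow>
    (\<forall>x x'. (\<forall>y. bracket y x = bracket y x') \<longrightarrow> x = x')"

definition subsemimodule ::
    "('x::comm_monoid_add \<Rightarrow> 'k::idem_semiring \<Rightarrow> 'x) \<Rightarrow> 'x set \<Rightarrow> bool"
  where "subsemimodule rscale V \<longleftrightarrow>
    (\<forall>x\<in>V. \<forall>z\<in>V. \<forall>l m. rscale x l + rscale z m \<in> V)"

definition complete_subsemimodule ::
    "('x::complete_idem_monoid \<Rightarrow> 'k::idem_semiring \<Rightarrow> 'x) \<Rightarrow> 'x set \<Rightarrow> bool"
  where "complete_subsemimodule rscale V \<longleftrightarrow>
    subsemimodule rscale V \<and> (\<forall>Q\<subseteq>V. Sup Q \<in> V)"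

text \<open>
  The square of a semimodule: addition, order and suprema on the product type are the
  componentwise ones of the imported library theories.
\<close>

instance prod :: (idem_monoid, idem_monoid) idem_monoid
  by standard (simp add: less_eq_prod_def natural_order prod_eq_iff)

instance prod :: (complete_idem_monoid, complete_idem_monoid) complete_idem_monoid ..

definition square_rscale :: "('x \<Rightarrow> 'k \<Rightarrow> 'x) \<Rightarrow> 'x \<times> 'x \<Rightarrow> 'k \<Rightarrow> 'x \<times> 'x"
  where "square_rscale rscale p l = (rscale (fst p) l, rscale (snd p) l)"

lemma (in complete_right_semimodule) complete_right_semimodule_square:
  "complete_right_semimodule (square_rscale rscale)"
  using rscale_continuous_left rscale_continuous_right
  by unfold_locales
    (auto simp: square_rscale_def prod_eq_iff rscale_add_left rscale_add_right rscale_mult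
      rscale_zero_left rscale_zero_right rscale_one vee_continuous_def fst_Sup snd_Sup image_image)

definition congruence ::
    "('x::comm_monoid_add \<Rightarrow> 'k::idem_semiring \<Rightarrow> 'x) \<Rightarrow> ('x \<times> 'x) set \<Rightarrow> bool"
  where "congruence rscale W \<longleftrightarrow>
    subsemimodule (square_rscale rscale) W \<and> equiv UNIV W"

definition complete_congruence ::
    "('x::complete_idem_monoid \<Rightarrow> 'k::idem_semiring \<Rightarrow> 'x) \<Rightarrow> ('x \<times> 'x) set \<Rightarrow> bool"
  where "complete_congruence rscale W \<longleftrightarrow>
    congruence rscale W \<and> complete_subsemimodule (square_rscale rscale) W"

end

(*
  Every congruence class has a greatest element, and two elements are congruent once each lies
  below the greatest element of the other's class. So, up to exchanging s and t, s is not below the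
  greatest element z of the class of t. Let y be the join of all y' with <y'|z> <= phi. Reflexivity
  and separation give <y|x> <= phi iff x <= z. Since z is the greatest element of its class, the
  condition x l <= z depends only on the class of x, and these conditions for all l determine
  <y|x>; hence y is constant on classes, whereas <y|t> <= phi and not <y|s> <= phi.
*)
theory Submission
  imports Defs
begin

lemma (in idem_monoid) add_le_iff: "a + b \<le> c \<longleftrightarrow> a \<le> c \<and> b \<le> c"
proof
  assume "a + b \<le> c"
  then have "a + b + c = c"
    by (simp add: natural_order)
  moreover have "a + a = a" "b + b = b"
    by (simp_all flip: natural_order)
  ultimately show "a \<le> c \<and> b \<le> c"
    unfolding natural_order by (metis add.assoc add.commute)
next
  assume "a \<le> c \<and> b \<le> c"
  then show "a + b \<le> c"
    by (simp add: natural_order add.assoc)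
qed

context complete_idem_semiring
begin

text \<open>The multipliers m with m * a \<le> \<phi> determine \<open>left_dual \<phi> a\<close> as
  their join, and \<open>right_dual \<phi>\<close> recovers a from it. Equality in the semiring can
  thus be tested by comparisons with \<phi> alone.\<close>

lemma left_dual_eqI:
  assumes "right_dual \<phi> (left_dual \<phi> a) = a" "right_dual \<phi> (left_dual \<phi> b) = b"
    and "\<And>m. m * a \<le> \<phi> \<longleftrightarrow> m * b \<le> \<phi>"
  shows "a = b"
proof -
  have "left_dual \<phi> a = left_dual \<phi> b"
    by (simp add: left_dual_def assms(3))
  then show ?thesis
    using assms(1,2) by metis
qed

text \<open>Both sides are needed: a left multiplier is absorbed into Y by
  \<open>bracket_lscale\<close>, a right multiplier into X by \<open>bracket_rscale\<close>.\<close>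

lemma right_dual_eqI:
  assumes "left_dual \<phi> (right_dual \<phi> a) = a" "left_dual \<phi> (right_dual \<phi> b) = b"
    and "\<And>m. a * m \<le> \<phi> \<longleftrightarrow> b * m \<le> \<phi>"
  shows "a = b"
proof -
  have "right_dual \<phi> a = right_dual \<phi> b"
    by (simp add: right_dual_def assms(3))
  then show ?thesis
    using assms(1,2) by metis
qed

end

context pre_dual_pair
begin

lemma bracket_add_right: "bracket y (x + z) = bracket y x + bracket y z"
  and bracket_rscale: "bracket y (rscale x l) = bracket y x * l"
  using bracket_right_linear by (auto simp: right_linear_def)

lemma bracket_lscale: "bracket (lscale l y) x = l * bracket y x"
  using bracket_left_linear by (auto simp: left_linear_def)

lemma bracket_Sup_le_iff: "bracket (Sup Q) x \<le> a \<longleftrightarrow> (\<forall>y\<in>Q. bracket y x \<le> a)"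
  using bracket_continuous_left by (simp add: vee_continuous_def Sup_le_iff)

lemma principal_ideal_representable:
  assumes "separates bracket"
    and reflexive: "\<And>l. right_dual \<phi> (left_dual \<phi> l) = l"
  obtains y where "\<And>x. bracket y x \<le> \<phi> \<longleftrightarrow> x \<le> z"
proof
  fix x
  show "bracket (Sup {y. bracket y z \<le> \<phi>}) x \<le> \<phi> \<longleftrightarrow> x \<le> z"
  proof
    assume "bracket (Sup {y. bracket y z \<le> \<phi>}) x \<le> \<phi>"
    \<comment> \<open>By continuity, the bound on the join holds for each of its members.\<close>
    then have below: "bracket y x \<le> \<phi>" if "bracket y z \<le> \<phi>" for y
      using that by (auto simp: bracket_Sup_le_iff)
    \<comment> \<open>Separation yields only equalities, so x \<le> z is sought in the form x + z =
      z.\<close>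
    have "bracket y (x + z) = bracket y z" for y
    proof (rule left_dual_eqI[OF reflexive reflexive])
      fix m
      show "m * bracket y (x + z) \<le> \<phi> \<longleftrightarrow> m * bracket y z \<le> \<phi>"
        \<comment> \<open>Scaling y by m shows that m * \<open>bracket y z\<close> \<le> \<phi>
          forces m * \<open>bracket y x\<close> \<le> \<phi>, so the summand x adds no
          constraint.\<close>
        using below[of "lscale m y"]
        by (auto simp: bracket_add_right bracket_lscale distrib_left add_le_iff)
    qed
    then have "x + z = z"
      using \<open>separates bracket\<close> by (auto simp: separates_def)
    then show "x \<le> z"
      by (simp add: natural_order)
  next
    assume "x \<le> z"
    then have "bracket y x + bracket y z = bracket y z" for y
      by (simp add: natural_order flip: bracket_add_right)
    then have "bracket y x \<le> bracket y z" for y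
      by (simp add: natural_order)
    then show "bracket (Sup {y. bracket y z \<le> \<phi>}) x \<le> \<phi>"
      by (auto simp: bracket_Sup_le_iff intro: order_trans)
  qed
qed

end

lemma congruence_add:
  assumes "right_semimodule rscale" "congruence rscale W" "(a, b) \<in> W"
  shows "(a + c, b + c) \<in> W"
proof -
  interpret right_semimodule rscale by fact
  have "(c, c) \<in> W"
    using assms by (auto simp: congruence_def equiv_def refl_on_def)
  with assms have "square_rscale rscale (a, b) 1 + square_rscale rscale (c, c) 1 \<in> W"
    unfolding congruence_def subsemimodule_def by blast
  then show ?thesis
    by (simp add: square_rscale_def rscale_one)
qed

lemma congruence_rscale:
  assumes "right_semimodule rscale" "congruence rscale W" "(a, b) \<in> W"
  shows "(rscale a l, rscale b l) \<in> W"
proof -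
  interpret right_semimodule rscale by fact
  \<comment> \<open>Stability is stated for two-term combinations; the scalar 0 removes the second
    term.\<close>
  from assms have "square_rscale rscale (a, b) l + square_rscale rscale (a, b) 0 \<in> W"
    unfolding congruence_def subsemimodule_def by blast
  then show ?thesis
    by (simp add: square_rscale_def rscale_zero_right)
qed

lemma complete_congruence_greatest:
  assumes "complete_congruence rscale W"
  obtains z where "(t, z) \<in> W" "\<And>u. (t, u) \<in> W \<Longrightarrow> u \<le> z"
proof
  \<comment> \<open>Reflexivity makes the set of pairs in W over t nonempty. Otherwise the first
    component of its join would be 0 instead of t.\<close>
  have "(t, t) \<in> W"
    using assms by (auto simp: complete_congruence_def congruence_def equiv_def refl_on_def)
  then have "fst ` (W \<inter> {t} \<times> UNIV) = {t}"
    by force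
  then have "Sup (W \<inter> {t} \<times> UNIV) = (t, Sup (snd ` (W \<inter> {t} \<times> UNIV)))"
    by (simp add: prod_eq_iff fst_Sup snd_Sup)
  moreover have "Sup (W \<inter> {t} \<times> UNIV) \<in> W"
    using assms by (auto simp: complete_congruence_def complete_subsemimodule_def)
  ultimately show "(t, Sup (snd ` (W \<inter> {t} \<times> UNIV))) \<in> W"
    by simp
  show "u \<le> Sup (snd ` (W \<inter> {t} \<times> UNIV))" if "(t, u) \<in> W" for u
    using that by (intro Sup_upper) force
qed

text \<open>Adding z to both sides makes z = f + z congruent to g + z. Hence g + z lies in the class
  of t and is bounded by its greatest element z.\<close>

lemma greatest_le_cong:
  fixes rscale :: "'x::idem_monoid \<Rightarrow> 'k::idem_semiring \<Rightarrow> 'x"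
  assumes "right_semimodule rscale" "congruence rscale W"
    and z: "(t, z) \<in> W" "\<And>u. (t, u) \<in> W \<Longrightarrow> u \<le> z"
    and "(f, g) \<in> W" "f \<le> z"
  shows "g \<le> z"
proof -
  have "(f + z, g + z) \<in> W"
    using assms(1,2,5) by (rule congruence_add)
  moreover have "f + z = z"
    using \<open>f \<le> z\<close> by (simp add: natural_order)
  ultimately have "(t, g + z) \<in> W"
    using assms(2) z(1) by (auto simp: congruence_def equiv_def dest: transD)
  then show ?thesis
    using z(2) add_le_iff by blast
qed

text \<open>The bound z on s passes to z', which is congruent to s, and likewise z' bounds z. The
  two classes thus share their greatest element.\<close>

lemma congruent_if_le_greatest:
  fixes rscale :: "'x::idem_monoid \<Rightarrow> 'k::idem_semiring \<Rightarrow> 'x"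
  assumes "right_semimodule rscale" "congruence rscale W"
    and z: "(t, z) \<in> W" "\<And>u. (t, u) \<in> W \<Longrightarrow> u \<le> z"
    and z': "(s, z') \<in> W" "\<And>u. (s, u) \<in> W \<Longrightarrow> u \<le> z'"
    and "s \<le> z" "t \<le> z'"
  shows "(s, t) \<in> W"
proof -
  have "z' \<le> z" "z \<le> z'"
    using greatest_le_cong[OF assms(1,2) z z'(1)] greatest_le_cong[OF assms(1,2) z' z(1)]
      \<open>s \<le> z\<close> \<open>t \<le> z'\<close> by auto
  then show ?thesis
    using assms(2) z(1) z'(1) by (auto simp: congruence_def equiv_def dest: transD symD)
qed

lemma separating_functional:
  fixes rscale :: "'x::complete_idem_monoid \<Rightarrow> 'k::reflexive_semiring \<Rightarrow> 'x"
    and lscale :: "'k \<Rightarrow> 'y::complete_idem_monoid \<Rightarrow> 'y"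
  assumes "pre_dual_pair rscale lscale bracket" "separates bracket" "congruence rscale W"
    and z: "(t, z) \<in> W" "\<And>u. (t, u) \<in> W \<Longrightarrow> u \<le> z"
    and "\<not> s \<le> z"
  shows "\<exists>y. (\<forall>f g. (f, g) \<in> W \<longrightarrow> bracket y f = bracket y g) \<and> bracket y s \<noteq> bracket y t"
proof -
  interpret pre_dual_pair rscale lscale bracket by fact
  have semimodule: "right_semimodule rscale" ..
  obtain \<phi> :: 'k where \<phi>: "\<And>l. left_dual \<phi> (right_dual \<phi> l) = l"
      "\<And>l. right_dual \<phi> (left_dual \<phi> l) = l"
    using ex_reflexive by blast
  obtain y where y: "\<And>x. bracket y x \<le> \<phi> \<longleftrightarrow> x \<le> z"
    using principal_ideal_representable \<open>separates bracket\<close> \<phi>(2) by blast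
  have refl: "(t, t) \<in> W" and sym: "(f, g) \<in> W \<Longrightarrow> (g, f) \<in> W" for f g
    using \<open>congruence rscale W\<close> by (auto simp: congruence_def equiv_def refl_on_def dest: symD)
  \<comment> \<open>By the choice of y, testing \<open>bracket y f\<close> * m against \<phi>
    amounts to testing \<open>rscale f m\<close> against z.\<close>
  have "bracket y f = bracket y g" if "(f, g) \<in> W" for f g
  proof (rule right_dual_eqI[OF \<phi>(1) \<phi>(1)])
    fix m
    have "(rscale f m, rscale g m) \<in> W"
      using congruence_rscale[OF semimodule assms(3) that] .
    then have "rscale f m \<le> z \<longleftrightarrow> rscale g m \<le> z"
      using greatest_le_cong[OF semimodule assms(3) z] sym by blast
    then show "bracket y f * m \<le> \<phi> \<longleftrightarrow> bracket y g * m \<le> \<phi>"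
      by (simp add: y flip: bracket_rscale)
  qed
  moreover have "bracket y s \<noteq> bracket y t"
    using y[of s] y[of t] z(2)[OF refl] \<open>\<not> s \<le> z\<close> by auto
  ultimately show ?thesis
    by blast
qed

theorem corollary1:
  fixes rscale :: "'x::complete_idem_monoid \<Rightarrow> 'k::reflexive_semiring \<Rightarrow> 'x"
    and lscale :: "'k \<Rightarrow> 'y::complete_idem_monoid \<Rightarrow> 'y"
    and bracket :: "'y \<Rightarrow> 'x \<Rightarrow> 'k"
    and W :: "('x \<times> 'x) set"
    and s t :: 'x
  assumes "pre_dual_pair rscale lscale bracket"
    and "separates bracket"
    and "complete_congruence rscale W"
    and "(s, t) \<notin> W"
  shows "\<exists>y. (\<forall>f g. (f, g) \<in> W \<longrightarrow> bracket y f = bracket y g) \<and> bracket y s \<noteq> bracket y t"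
proof -
  interpret pre_dual_pair rscale lscale bracket by fact
  have semimodule: "right_semimodule rscale" ..
  have W: "congruence rscale W"
    using assms(3) by (simp add: complete_congruence_def)
  obtain z where z: "(t, z) \<in> W" "\<And>u. (t, u) \<in> W \<Longrightarrow> u \<le> z"
    using complete_congruence_greatest[OF assms(3)] by blast
  obtain z' where z': "(s, z') \<in> W" "\<And>u. (s, u) \<in> W \<Longrightarrow> u \<le> z'"
    using complete_congruence_greatest[OF assms(3)] by blast
  consider "\<not> s \<le> z" | "\<not> t \<le> z'"
    using congruent_if_le_greatest[OF semimodule W z z'] assms(4) by blast
  then show ?thesis
  proof cases
    case 1
    then show ?thesis
      using separating_functional[OF assms(1,2) W z] by blast
  next
    \<comment> \<open>Here s and t exchange roles; the resulting inequality is symmetric in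
      them.\<close>
    case 2
    then show ?thesis
      using separating_functional[OF assms(1,2) W z'] by metis
  qed
qed

end
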